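(* Let $n\geq 2$ be an integer and let $k>2$ be an even integer. Then $P_k^{r,r+1}(n-1)$ is Eulerian for every $r\in\mathbb{Z}$ satisfying $n\leq r<(k-1)n$.
   Context: A $k$-ary $n$-tuple is an element of $\mathbb{Z}_k^n$, with entries identified with the integers $0,1,\dots,k-1$. The de Bruijn digraph $B_k(n-1)$ has vertex set $\mathbb{Z}_k^{n-1}$, and its edges are identified with the $k$-ary $n$-tuples: the $n$-tuple $(x_0,\dots,x_{n-1})$ is the edge from vertex $(x_0,\dots,x_{n-2})$ to vertex $(x_1,\dots,x_{n-1})$ (loops allowed). A subgraph "consisting of" a set of edges has exactly those edges, and its vertices are the vertices incident with at least one of them. A digraph is Eulerian if it is strongly connected (there is a directed path between any ordered pair of its vertices) and balanced (every vertex has in-degree equal to out-degree). Define $f:\mathbb{Z}_k\to\mathbb{Q}$ by $f(a)=a$ (as an integer in $[0,k-1]$) if $a\neq 0$, and $f(0)=k/2$. The pseudoweight of a $k$-ary $n$-tuple $\mathbf{a}=(a_0,\dots,a_{n-1})$ is $w_p(\mathbf{a})=\sum_{i=0}^{n-1}f(a_i)$, computed in $\mathbb{Q}$. For $0\leq r\leq s\leq (k-1)n$, $P_k^{r,s}(n-1)$ is the subgraph of $B_k(n-1)$ consisting of the edges corresponding to $n$-tuples $\mathbf{a}$ with $r\leq w_p(\mathbf{a})\leq s$. *)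

theory Defs
  imports Complex_Main "Graph_Theory.Digraph" "Graph_Theory.Digraph_Component"
begin

text \<open>Elements of \<open>\<int>\<^sub>k\<close> are represented by the naturals \<open>0, \<dots>, k - 1\<close>,
  and \<open>k\<close>-ary \<open>n\<close>-tuples by lists of length \<open>n\<close>.\<close>

definition kary_tuples :: "nat \<Rightarrow> nat \<Rightarrow> nat list set" where
  "kary_tuples k n = {a. length a = n \<and> set a \<subseteq> {0..<k}}"

text \<open>\<open>de_bruijn k m\<close> is the digraph \<open>B\<^sub>k(m)\<close>: the argument is the length of the vertices,
  and the edges are the tuples of length \<open>m + 1\<close>.\<close>

definition de_bruijn :: "nat \<Rightarrow> nat \<Rightarrow> (nat list, nat list) pre_digraph" where
  "de_bruijn k m =
    \<lparr> verts = kary_tuples k m, arcs = kary_tuples k (m + 1), tail = butlast, head = tl \<rparr>"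

definition arc_subgraph :: "('a, 'b) pre_digraph \<Rightarrow> 'b set \<Rightarrow> ('a, 'b) pre_digraph" where
  "arc_subgraph G E =
    \<lparr> verts = tail G ` E \<union> head G ` E, arcs = E, tail = tail G, head = head G \<rparr>"

definition balanced :: "('a, 'b) pre_digraph \<Rightarrow> bool" where
  "balanced G \<longleftrightarrow> (\<forall>v \<in> verts G. in_degree G v = out_degree G v)"

text \<open>The library's \<^const>\<open>strongly_connected\<close> also requires the vertex set to be nonempty.\<close>

definition eulerian :: "('a, 'b) pre_digraph \<Rightarrow> bool" where
  "eulerian G \<longleftrightarrow> strongly_connected G \<and> balanced G"

definition pseudo_value :: "nat \<Rightarrow> nat \<Rightarrow> rat" where
  "pseudo_value k a = (if a = 0 then of_nat k / 2 else of_nat a)"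

definition pseudoweight :: "nat \<Rightarrow> nat list \<Rightarrow> rat" where
  "pseudoweight k a = (\<Sum>x\<leftarrow>a. pseudo_value k x)"

text \<open>\<open>pseudoweight_digraph k r s m\<close> is the digraph \<open>P\<^sub>k\<^sup>r\<^sup>,\<^sup>s(m)\<close>, a subgraph of
  \<open>B\<^sub>k(m)\<close>. The bounds are rational because pseudoweights are half-integral for odd \<open>k\<close>.\<close>

definition pseudoweight_digraph ::
    "nat \<Rightarrow> rat \<Rightarrow> rat \<Rightarrow> nat \<Rightarrow> (nat list, nat list) pre_digraph" where
  "pseudoweight_digraph k r s m =
    arc_subgraph (de_bruijn k m)
      {a \<in> arcs (de_bruijn k m). r \<le> pseudoweight k a \<and> pseudoweight k a \<le> s}"

lemma fin_digraph_de_bruijn: "fin_digraph (de_bruijn k m)"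
proof
  have fin: "finite (kary_tuples k j)" for j
    using finite_lists_length_eq[of "{0..<k}" j]
    by (simp add: kary_tuples_def conj_commute)
  show "finite (verts (de_bruijn k m))" "finite (arcs (de_bruijn k m))"
    by (simp_all add: de_bruijn_def fin)
next
  fix e assume "e \<in> arcs (de_bruijn k m)"
  then show "tail (de_bruijn k m) e \<in> verts (de_bruijn k m)"
    "head (de_bruijn k m) e \<in> verts (de_bruijn k m)"
    by (auto simp: de_bruijn_def kary_tuples_def dest: in_set_butlastD list.set_sel(2)[rotated])
qed

lemma subgraph_pseudoweight_digraph:
  "subgraph (pseudoweight_digraph k r s m) (de_bruijn k m)"
proof -
  interpret B: fin_digraph "de_bruijn k m" by (rule fin_digraph_de_bruijn)
  show ?thesis
  proof (rule subgraphI)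
    show "verts (pseudoweight_digraph k r s m) \<subseteq> verts (de_bruijn k m)"
      by (auto simp: pseudoweight_digraph_def arc_subgraph_def)
    show "arcs (pseudoweight_digraph k r s m) \<subseteq> arcs (de_bruijn k m)"
      by (auto simp: pseudoweight_digraph_def arc_subgraph_def)
    show "compatible (de_bruijn k m) (pseudoweight_digraph k r s m)"
      by (simp add: compatible_def pseudoweight_digraph_def arc_subgraph_def)
    show "wf_digraph (de_bruijn k m)" by (rule B.wf_digraph)
    show "wf_digraph (pseudoweight_digraph k r s m)"
      by unfold_locales (auto simp: pseudoweight_digraph_def arc_subgraph_def)
  qed
qed

end

theory Submission
  imports Defs
begin

text \<open>Rotating an arc of the de Bruijn digraph moves its tail to its head. A set of arcs closed
  under rotation therefore spans a union of closed walks, which gives balance, and two of its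
  tuples that differ in one entry share a vertex after a suitable rotation. For even \<open>k\<close> the
  pseudoweight is the ordinary sum once every \<open>0\<close> is replaced by \<open>k / 2\<close>, and these replacements
  change one entry at a time. Two tuples of sum \<open>r\<close> over \<open>{1..k - 1}\<close> are then connected by
  repeatedly increasing one entry (reaching sum \<open>r + 1\<close>) and decreasing another, each pair of
  changes bringing the first tuple closer to the second.\<close>

section \<open>De Bruijn subgraphs closed under rotation\<close>

lemma rotate_mem:
  assumes "\<And>a. a \<in> E \<Longrightarrow> rotate1 a \<in> E" and "a \<in> E"
  shows "rotate j a \<in> E"
  using assms by (induction j) auto

lemma butlast_rotate1: "a \<noteq> [] \<Longrightarrow> butlast (rotate1 a) = tl a"
  by (cases a) auto

lemma arc_subgraph_sel [simp]:
  "arcs (arc_subgraph G E) = E"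
  "tail (arc_subgraph G E) = tail G"
  "head (arc_subgraph G E) = head G"
  "verts (arc_subgraph G E) = tail G ` E \<union> head G ` E"
  by (simp_all add: arc_subgraph_def)

lemma de_bruijn_sel [simp]:
  "arcs (de_bruijn k m) = kary_tuples k (m + 1)"
  "tail (de_bruijn k m) = butlast"
  "head (de_bruijn k m) = tl"
  by (simp_all add: de_bruijn_def)

lemma wf_arc_subgraph: "wf_digraph (arc_subgraph G E)"
  by unfold_locales auto

text \<open>The tail of \<open>rotate1 a\<close> is the head of \<open>a\<close>, so
  \<open>rotate1\<close> maps the arcs entering a vertex bijectively onto those leaving it.\<close>

lemma balanced_rotation_closed:
  assumes rot: "\<And>a. a \<in> E \<Longrightarrow> rotate1 a \<in> E" and ne: "[] \<notin> E"
  shows "balanced (arc_subgraph (de_bruijn k m) E)"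
  unfolding balanced_def
proof
  fix v
  let ?G = "arc_subgraph (de_bruijn k m) E"
  have "bij_betw rotate1 (in_arcs ?G v) (out_arcs ?G v)"
    unfolding bij_betw_def
  proof
    show "inj_on rotate1 (in_arcs ?G v)"
      by (rule inj_on_subset[OF inj_rotate1]) simp
    show "rotate1 ` in_arcs ?G v = out_arcs ?G v"
    proof (intro equalityI subsetI)
      fix b assume "b \<in> rotate1 ` in_arcs ?G v"
      then obtain a where a: "b = rotate1 a" "a \<in> E" "tl a = v" by auto
      moreover have "a \<noteq> []" using a ne by auto
      ultimately show "b \<in> out_arcs ?G v"
        using rot by (simp add: butlast_rotate1)
    next
      fix b assume "b \<in> out_arcs ?G v"
      then have b: "b \<in> E" "butlast b = v" by auto
      \<comment> \<open>The inverse rotation is written as a power of \<open>rotate1\<close>, so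
        closure of \<open>E\<close> under \<open>rotate1\<close> also covers it.\<close>
      define a where "a = rotate (length b - 1) b"
      have "b \<noteq> []" using b ne by auto
      then have ab: "rotate1 a = b"
        by (simp add: a_def flip: rotate_Suc)
      have "a \<in> E" unfolding a_def using rot b(1) by (rule rotate_mem)
      moreover have "tl a = v"
        using ab b(2) butlast_rotate1[of a] \<open>a \<in> E\<close> ne by metis
      ultimately show "b \<in> rotate1 ` in_arcs ?G v"
        using ab by (auto intro!: image_eqI[of _ _ a])
    qed
  qed
  then show "in_degree ?G v = out_degree ?G v"
    unfolding in_degree_def out_degree_def by (rule bij_betw_same_card)
qed

definition change_entry :: "'a list set \<Rightarrow> 'a list \<Rightarrow> 'a list \<Rightarrow> bool" where
  "change_entry E a b \<longleftrightarrow>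
    a \<in> E \<and> b \<in> E \<and> (\<exists>u x y v. a = u @ x # v \<and> b = u @ y # v)"

lemma change_entry_sym: "change_entry E a b \<Longrightarrow> change_entry E b a"
  unfolding change_entry_def by blast

lemma change_entry_rtranclp_sym: "(change_entry E)\<^sup>*\<^sup>* a b \<Longrightarrow> (change_entry E)\<^sup>*\<^sup>* b a"
  by (metis change_entry_sym sympI symp_rtranclp sympD)

lemma change_entry_list_update:
  assumes "a \<in> E" "a[i := y] \<in> E" "i < length a"
  shows "change_entry E a (a[i := y])"
  using assms id_take_nth_drop[of i a] upd_conv_take_nth_drop[of i a y]
  unfolding change_entry_def by blast

text \<open>Reduces reachability to chains of single-entry changes: walks along rotations bring the
  changed entry to the end, where \<open>butlast\<close> forgets it.\<close>

lemma strongly_connected_rotation_closed: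
  fixes k m :: nat and E :: "nat list set"
  assumes rot: "\<And>a. a \<in> E \<Longrightarrow> rotate1 a \<in> E" and ne: "[] \<notin> E" and nonempty: "E \<noteq> {}"
    and conn: "\<And>a b. a \<in> E \<Longrightarrow> b \<in> E \<Longrightarrow> (change_entry E)\<^sup>*\<^sup>* a b"
  shows "strongly_connected (arc_subgraph (de_bruijn k m) E)"
proof -
  let ?G = "arc_subgraph (de_bruijn k m) E"
  interpret wf_digraph ?G by (rule wf_arc_subgraph)
  have refl: "butlast a \<rightarrow>\<^sup>*\<^bsub>?G\<^esub> butlast a" if "a \<in> E" for a
    using that by auto
  have step: "butlast a \<rightarrow>\<^sup>*\<^bsub>?G\<^esub> butlast (rotate1 a)" if "a \<in> E" for a
  proof -
    have "a \<noteq> []" using that ne by auto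
    then show ?thesis
      using in_arcs_imp_in_arcs_ends[of a] that by (auto simp: butlast_rotate1)
  qed
  have rotate: "butlast a \<rightarrow>\<^sup>*\<^bsub>?G\<^esub> butlast (rotate j a)" if "a \<in> E" for a j
  proof (induction j)
    case (Suc j)
    then show ?case
      using step[OF rotate_mem[OF rot that]] reachable_trans by auto
  qed (use refl that in simp)
  have rotate_back: "butlast (rotate j a) \<rightarrow>\<^sup>*\<^bsub>?G\<^esub> butlast a" if "a \<in> E" for a j
  proof -
    have "a \<noteq> []" using that ne by auto
    \<comment> \<open>Rotation walks are closed, so going back amounts to completing the current
      turn. Reducing \<open>j\<close> first keeps the truncated difference meaningful.\<close>
    have "rotate (length a - j mod length a) (rotate j a)
        = rotate (length a - j mod length a) (rotate (j mod length a) a)"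
      by (metis rotate_conv_mod)
    also have "\<dots> = rotate (length a) a"
      using \<open>a \<noteq> []\<close> by (simp only: rotate_rotate) simp
    also have "\<dots> = a" by simp
    finally show ?thesis
      using rotate[OF rotate_mem[OF rot that]] by metis
  qed
  have change: "butlast a \<rightarrow>\<^sup>*\<^bsub>?G\<^esub> butlast b" if ab: "change_entry E a b" for a b
  proof -
    obtain u x y v where uv: "a = u @ x # v" "b = u @ y # v" "a \<in> E" "b \<in> E"
      using ab unfolding change_entry_def by blast
    \<comment> \<open>One rotation beyond \<open>length u\<close> puts the entry \<open>z\<close>
      last, so the rotated versions of \<open>a\<close> and \<open>b\<close> have the same
      tail.\<close>
    have "rotate (Suc (length u)) (u @ z # v) = v @ u @ [z]" for z
      using rotate_append[of "u @ [z]" v] by simp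
    then have "butlast (rotate (Suc (length u)) a) = butlast (rotate (Suc (length u)) b)"
      by (simp add: uv butlast_append del: rotate_Suc)
    then show ?thesis
      using rotate[OF uv(3)] rotate_back[OF uv(4)] reachable_trans by metis
  qed
  have walk: "butlast a \<rightarrow>\<^sup>*\<^bsub>?G\<^esub> butlast b" if "(change_entry E)\<^sup>*\<^sup>* a b" "a \<in> E" for a b
    using that
  proof (induction rule: rtranclp_induct)
    case base
    then show ?case by (rule refl)
  next
    case (step b c)
    from step.IH[OF step.prems] change[OF step.hyps(2)] show ?case by (rule reachable_trans)
  qed
  \<comment> \<open>Every head is also the tail of the rotated arc, so walks between tails
    suffice.\<close>
  have verts: "verts ?G = butlast ` E"
  proof -
    have "tl a \<in> butlast ` E" if "a \<in> E" for a
      using that ne rot[OF that] butlast_rotate1[of a] by (metis imageI)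
    then show ?thesis by auto
  qed
  show ?thesis
  proof (rule strongly_connectedI)
    show "verts ?G \<noteq> {}" using nonempty by auto
  qed (use walk conn in \<open>auto simp del: arc_subgraph_sel(4) simp: verts\<close>)
qed

section \<open>Tuples of sum at most one above a given number\<close>

text \<open>Entries start at 1: on tuples without 0 the pseudoweight is the ordinary sum.\<close>

definition sum_band :: "nat \<Rightarrow> nat \<Rightarrow> nat \<Rightarrow> nat list set" where
  "sum_band m n R = {a. length a = n \<and> set a \<subseteq> {1..m} \<and> (sum_list a = R \<or> sum_list a = Suc R)}"

lemma list_update_mem_sum_band:
  assumes "length a = n" "set a \<subseteq> {1..m}" "1 \<le> y" "y \<le> m"
    "sum_list (a[i := y]) = R \<or> sum_list (a[i := y]) = Suc R"
  shows "a[i := y] \<in> sum_band m n R"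
  using assms set_update_subset_insert[of a i y] by (auto simp: sum_band_def)

lemma exists_list_of_sum:
  assumes "n \<le> R" "R \<le> m * n"
  shows "\<exists>a. length a = n \<and> set a \<subseteq> {1..m} \<and> sum_list a = (R::nat)"
  using assms
proof (induction n arbitrary: R)
  case (Suc n)
  have m: "1 \<le> m" using Suc.prems by (cases m) auto
  \<comment> \<open>Greedy choice: the first entry is as large as possible while leaving at least 1
    for each of the \<open>n\<close> remaining entries.\<close>
  define x where "x = min m (R - n)"
  have x: "1 \<le> x" "x \<le> m" "x \<le> R" "n \<le> R - x"
    using Suc.prems m by (auto simp: x_def)
  have "R - x \<le> m * n"
  proof (cases "m \<le> R - n")
    case True
    then show ?thesis using Suc.prems by (simp add: x_def)
  next
    case False
    then have "R - x = n" using Suc.prems by (simp add: x_def)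
    then show ?thesis using m by simp
  qed
  then obtain a where "length a = n" "set a \<subseteq> {1..m}" "sum_list a = R - x"
    using Suc.IH x(4) by blast
  then show ?case
    using x by (intro exI[of _ "x # a"]) auto
qed simp

text \<open>Otherwise \<open>a\<close> would lie entrywise below \<open>b\<close>, strictly
  somewhere, and have the smaller sum.\<close>

lemma exists_greater_entry:
  fixes a b :: "nat list"
  assumes "length a = length b" "sum_list b \<le> sum_list a" "a \<noteq> b"
  obtains i where "i < length a" "b ! i < a ! i"
proof (rule ccontr)
  assume "\<not> thesis"
  then have le: "\<forall>i<length a. a ! i \<le> b ! i" using that by (meson not_le)
  obtain j where j: "j < length a" "a ! j \<noteq> b ! j"
    using assms(1,3) by (meson nth_equalityI)
  have "(\<Sum>i = 0..<length a. a ! i) < (\<Sum>i = 0..<length a. b ! i)"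
    by (rule sum_strict_mono_ex1) (use le j in \<open>auto intro!: bexI[of _ j] simp: le_less\<close>)
  then show False using assms(1,2) by (simp add: sum_list_sum_nth)
qed

lemma change_entry_equal_sum:
  assumes "length a = n" "set a \<subseteq> {1..m}" "sum_list a = R"
    and "length b = n" "set b \<subseteq> {1..m}" "sum_list b = R"
  shows "(change_entry (sum_band m n R))\<^sup>*\<^sup>* a b"
  using assms(1-3)
  \<comment> \<open>The measure uses truncated subtraction: it adds up the excess of \<open>a\<close> over \<open>b\<close> only.\<close>
proof (induction "\<Sum>i<n. a ! i - b ! i" arbitrary: a rule: less_induct)
  case less
  let ?E = "sum_band m n R"
  show ?case
  proof (cases "a = b")
    case False
    obtain j where j: "j < n" "b ! j < a ! j"
      using exists_greater_entry[of a b] less.prems assms False by auto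
    obtain i where i: "i < n" "a ! i < b ! i"
      using exists_greater_entry[of b a] less.prems assms False by auto
    have ij: "i \<noteq> j" using i j by auto
    \<comment> \<open>The entries of \<open>b\<close> leave room for both changes:
      \<open>a ! i < b ! i \<le> m\<close> and \<open>1 \<le> b ! j < a ! j\<close>.\<close>
    have "b ! j \<in> {1..m}" "b ! i \<in> {1..m}" "a ! j \<in> {1..m}"
      using nth_mem[of j b] nth_mem[of i b] nth_mem[of j a] i(1) j(1) less.prems(1,2) assms(4,5)
      by (simp_all add: subset_iff)
    then have bounds: "1 \<le> b ! j" "b ! i \<le> m" "a ! j \<le> m" by auto
    \<comment> \<open>The increase comes first, since decreasing first would give sum
      \<open>R - 1\<close>, outside the band.\<close>
    define c where "c = a[i := Suc (a ! i)]"
    define d where "d = c[j := a ! j - 1]"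
    have cj: "c ! j = a ! j" using ij by (simp add: c_def)
    have sc: "sum_list c = Suc R"
      using less.prems i by (simp add: c_def sum_list_update)
    have sd: "sum_list d = R"
      using less.prems i j sc cj by (simp add: d_def sum_list_update c_def)
    have a: "a \<in> ?E" using less.prems by (simp add: sum_band_def)
    have c: "c \<in> ?E"
      unfolding c_def using less.prems sc i bounds
      by (intro list_update_mem_sum_band) (auto simp: c_def)
    have d: "d \<in> ?E"
      unfolding d_def using c sd j bounds
      by (intro list_update_mem_sum_band) (auto simp: d_def sum_band_def)
    have "change_entry ?E a c"
      using a c i less.prems unfolding c_def by (intro change_entry_list_update) auto
    moreover have "change_entry ?E c d"
      using c d j less.prems unfolding d_def
      by (intro change_entry_list_update) (auto simp: c_def)
    moreover have "(change_entry ?E)\<^sup>*\<^sup>* d b"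
    proof (rule less.hyps)
      have d_nth: "d ! l = (if l = j then a ! j - 1 else if l = i then Suc (a ! i) else a ! l)"
        if "l < n" for l
        using that less.prems ij by (auto simp: d_def c_def nth_list_update)
      \<comment> \<open>The excess drops by one at \<open>j\<close> and stays 0 at \<open>i\<close>,
        where \<open>d ! i\<close> is still at most \<open>b ! i\<close>.\<close>
      show "(\<Sum>l<n. d ! l - b ! l) < (\<Sum>l<n. a ! l - b ! l)"
        by (rule sum_strict_mono_ex1) (use i j ij d_nth in \<open>auto intro!: bexI[of _ j]\<close>)
    qed (use d sd in \<open>auto simp: sum_band_def\<close>)
    ultimately show ?thesis
      by (meson converse_rtranclp_into_rtranclp)
  qed simp
qed

text \<open>A tuple of sum \<open>Suc R\<close> is first lowered to sum \<open>R\<close> by one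
  change, which leaves the case of equal sums.\<close>

lemma change_entry_sum_band:
  assumes "n \<le> R" and a: "a \<in> sum_band m n R" and b: "b \<in> sum_band m n R"
  shows "(change_entry (sum_band m n R))\<^sup>*\<^sup>* a b"
proof -
  let ?E = "sum_band m n R"
  have lower: "\<exists>c. (change_entry ?E)\<^sup>*\<^sup>* a c \<and> length c = n \<and> set c \<subseteq> {1..m} \<and> sum_list c = R"
    if a: "a \<in> ?E" for a
  proof (cases "sum_list a = R")
    case True
    then show ?thesis using a by (auto simp: sum_band_def)
  next
    case False
    then have a': "length a = n" "set a \<subseteq> {1..m}" "sum_list a = Suc R"
      using a by (auto simp: sum_band_def)
    \<comment> \<open>Comparison with the all-ones tuple yields an entry that can be decreased
      without becoming 0; this uses \<open>n \<le> R\<close>.\<close>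
    have "sum_list (replicate n 1) < sum_list a"
      using a' assms(1) by (simp add: sum_list_replicate)
    then obtain i where i: "i < n" "1 < a ! i"
      using exists_greater_entry[of a "replicate n 1"] a'(1) by force
    let ?c = "a[i := a ! i - 1]"
    have "a ! i \<in> {1..m}" using nth_mem[of i a] i(1) a'(1,2) by (simp add: subset_iff)
    then have "a ! i \<le> m" by simp
    moreover have s: "sum_list ?c = R" using a' i by (simp add: sum_list_update)
    ultimately have c: "?c \<in> ?E"
      using a' i by (intro list_update_mem_sum_band) auto
    then have "change_entry ?E a ?c"
      using a a' i by (intro change_entry_list_update) auto
    then show ?thesis using c s by (auto simp: sum_band_def intro!: exI[of _ ?c])
  qed
  obtain c d where c: "(change_entry ?E)\<^sup>*\<^sup>* a c" "length c = n" "set c \<subseteq> {1..m}" "sum_list c = R"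
    and d: "(change_entry ?E)\<^sup>*\<^sup>* b d" "length d = n" "set d \<subseteq> {1..m}" "sum_list d = R"
    using lower[OF a] lower[OF b] by blast
  have "(change_entry ?E)\<^sup>*\<^sup>* c d"
    using c d by (intro change_entry_equal_sum)
  with c(1) change_entry_rtranclp_sym[OF d(1)] show ?thesis by auto
qed

section \<open>Pseudoweights for even alphabets\<close>

definition pseudo_band :: "nat \<Rightarrow> nat \<Rightarrow> int \<Rightarrow> nat list set" where
  "pseudo_band k n r =
    {a \<in> kary_tuples k n. of_int r \<le> pseudoweight k a \<and> pseudoweight k a \<le> of_int (r + 1)}"

text \<open>For even \<open>k\<close> the replacement \<open>k div 2\<close> has the same
  pseudovalue as 0.\<close>

definition fill :: "nat \<Rightarrow> nat \<Rightarrow> nat" where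
  "fill k x = (if x = 0 then k div 2 else x)"

lemma pseudo_value_fill: "even k \<Longrightarrow> pseudo_value k (fill k x) = pseudo_value k x"
  by (auto simp: pseudo_value_def fill_def elim!: evenE)

lemma pseudoweight_append: "pseudoweight k (a @ b) = pseudoweight k a + pseudoweight k b"
  by (simp add: pseudoweight_def)

lemma pseudoweight_Cons: "pseudoweight k (x # a) = pseudo_value k x + pseudoweight k a"
  by (simp add: pseudoweight_def)

lemma pseudoweight_positive: "0 \<notin> set a \<Longrightarrow> pseudoweight k a = of_nat (sum_list a)"
  by (induction a) (auto simp: pseudoweight_def pseudo_value_def)

text \<open>Allows chains of changes found in \<open>sum_band\<close> to be read as chains in
  \<open>pseudo_band\<close>.\<close>

lemma sum_band_subset_pseudo_band:
  assumes "0 \<le> r"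
  shows "sum_band (k - 1) n (nat r) \<subseteq> pseudo_band k n r"
proof
  fix a assume a: "a \<in> sum_band (k - 1) n (nat r)"
  then have "0 \<notin> set a" by (auto simp: sum_band_def)
  moreover have "of_nat (nat r) = (of_int r :: rat)" using assms by simp
  ultimately have "pseudoweight k a = of_int r \<or> pseudoweight k a = of_int r + 1"
    using a by (auto simp: sum_band_def pseudoweight_positive)
  then show "a \<in> pseudo_band k n r"
    using a by (fastforce simp: sum_band_def pseudo_band_def kary_tuples_def)
qed

text \<open>Entries are filled from left to right, with \<open>xs\<close> as the part already
  treated. No step alters the pseudoweight, so the chain stays in the band.\<close>

lemma change_entry_fill:
  assumes k: "even k" and "xs @ ys \<in> pseudo_band k n r"
  shows "(change_entry (pseudo_band k n r))\<^sup>*\<^sup>* (xs @ ys) (xs @ map (fill k) ys)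
    \<and> xs @ map (fill k) ys \<in> pseudo_band k n r"
  using assms(2)
proof (induction ys arbitrary: xs)
  case (Cons y ys)
  have next_mem: "xs @ fill k y # ys \<in> pseudo_band k n r"
  proof -
    have "y < k" using Cons.prems by (simp add: pseudo_band_def kary_tuples_def)
    then have "fill k y < k" by (auto simp: fill_def)
    then show ?thesis
      using Cons.prems k
      by (simp add: pseudo_band_def pseudoweight_append pseudoweight_Cons pseudo_value_fill
          kary_tuples_def)
  qed
  then have "change_entry (pseudo_band k n r) (xs @ y # ys) (xs @ fill k y # ys)"
    using Cons.prems unfolding change_entry_def by blast
  with Cons.IH[of "xs @ [fill k y]"] next_mem show ?case
    by (auto intro: converse_rtranclp_into_rtranclp)
qed simp

lemma fill_mem_sum_band:
  assumes "k > 2" "0 \<le> r" and a: "map (fill k) a \<in> pseudo_band k n r"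
  shows "map (fill k) a \<in> sum_band (k - 1) n (nat r)"
proof -
  let ?b = "map (fill k) a"
  have pos: "0 \<notin> set ?b" using assms(1) by (auto simp: fill_def)
  \<comment> \<open>Writing the weight as the image of an integer turns the rational bounds into
    integer ones, which leave only the sums \<open>r\<close> and \<open>r + 1\<close>.\<close>
  have weight: "pseudoweight k ?b = of_int (int (sum_list ?b))"
    using pseudoweight_positive[OF pos] by (simp only: of_int_of_nat_eq)
  have "of_int r \<le> (of_int (int (sum_list ?b)) :: rat)"
    "(of_int (int (sum_list ?b)) :: rat) \<le> of_int (r + 1)"
    using a unfolding pseudo_band_def weight[symmetric] by auto
  then have "r \<le> int (sum_list ?b)" "int (sum_list ?b) \<le> r + 1"
    unfolding of_int_le_iff by auto
  then have "sum_list ?b = nat r \<or> sum_list ?b = Suc (nat r)"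
    using assms(2) by linarith
  moreover have "length ?b = n" "set ?b \<subseteq> {0..<k}"
    using a unfolding pseudo_band_def kary_tuples_def by auto
  moreover have "set ?b \<subseteq> {1..k - 1}"
  proof
    fix x assume "x \<in> set ?b"
    then have "x \<noteq> 0" "x < k" using pos \<open>set ?b \<subseteq> {0..<k}\<close> by (metis, auto)
    then show "x \<in> {1..k - 1}" by auto
  qed
  ultimately show ?thesis unfolding sum_band_def by blast
qed

text \<open>The chain goes from \<open>a\<close> to its filled version, through
  \<open>sum_band\<close> to that of \<open>b\<close>, and back to \<open>b\<close> by
  symmetry.\<close>

lemma change_entry_pseudo_band:
  assumes "k > 2" "even k" "int n \<le> r" "a \<in> pseudo_band k n r" "b \<in> pseudo_band k n r"
  shows "(change_entry (pseudo_band k n r))\<^sup>*\<^sup>* a b"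
proof -
  let ?E = "pseudo_band k n r" and ?S = "sum_band (k - 1) n (nat r)"
  have r: "0 \<le> r" "n \<le> nat r" using assms(3) by linarith+
  have fill: "(change_entry ?E)\<^sup>*\<^sup>* c (map (fill k) c) \<and> map (fill k) c \<in> ?S" if "c \<in> ?E" for c
    using change_entry_fill[of k "[]" c] that assms(1,2) fill_mem_sum_band r by auto
  have "(change_entry ?S)\<^sup>*\<^sup>* (map (fill k) a) (map (fill k) b)"
    using fill assms(4,5) r by (intro change_entry_sum_band) auto
  moreover have "change_entry ?S \<le> change_entry ?E"
    using sum_band_subset_pseudo_band[OF r(1)] unfolding change_entry_def by blast
  ultimately have "(change_entry ?E)\<^sup>*\<^sup>* (map (fill k) a) (map (fill k) b)"
    using rtranclp_mono by blast
  then show ?thesis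
    using fill[OF assms(4)] change_entry_rtranclp_sym[of ?E b] fill[OF assms(5)]
    by (meson rtranclp_trans)
qed

theorem theorem5p6:
  fixes n k :: nat and r :: int
  assumes "n \<ge> 2" and "k > 2" and "even k"
    and "int n \<le> r" and "r < (int k - 1) * int n"
  shows "eulerian (pseudoweight_digraph k (of_int r) (of_int (r + 1)) (n - 1))"
proof -
  let ?E = "pseudo_band k n r"
  have digraph: "pseudoweight_digraph k (of_int r) (of_int (r + 1)) (n - 1)
      = arc_subgraph (de_bruijn k (n - 1)) ?E"
    using assms(1) by (simp add: pseudoweight_digraph_def pseudo_band_def)
  \<comment> \<open>Rotation only permutes the summands of the pseudoweight.\<close>
  have rot: "rotate1 a \<in> ?E" if "a \<in> ?E" for a
    using that by (cases a)
      (auto simp: pseudo_band_def kary_tuples_def pseudoweight_append pseudoweight_Cons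
        pseudoweight_def add.commute)
  have ne: "[] \<notin> ?E" using assms(1) by (auto simp: pseudo_band_def kary_tuples_def)
  have r: "0 \<le> r" "n \<le> nat r" using assms(4) by linarith+
  \<comment> \<open>The upper bound on \<open>r\<close> serves to make the arc set nonempty, as
    \<open>strongly_connected\<close> demands a vertex.\<close>
  have "int (nat r) \<le> int ((k - 1) * n)" using assms(2,5) r by (simp add: of_nat_diff)
  then have "nat r \<le> (k - 1) * n" by linarith
  with r(2) obtain a where "length a = n" "set a \<subseteq> {1..k - 1}" "sum_list a = nat r"
    using exists_list_of_sum by blast
  then have "a \<in> sum_band (k - 1) n (nat r)" by (simp add: sum_band_def)
  then have nonempty: "?E \<noteq> {}" using sum_band_subset_pseudo_band[OF r(1)] by blast
  show ?thesis
    unfolding eulerian_def digraph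
    using strongly_connected_rotation_closed[OF rot ne nonempty]
      balanced_rotation_closed[OF rot ne] change_entry_pseudo_band[OF assms(2,3,4)]
    by blast
qed

end
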